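(* Let $(\mathfrak g,[\cdot,\cdot,\cdot])$ be a finite-dimensional real $3$-Lie algebra, $\omega$ a symplectic structure on it, and $(\mathfrak g,\{\cdot,\cdot,\cdot\})$ the induced $3$-pre-Lie algebra, determined by $\omega(\{x,y,z\},w)=-\omega(z,[x,y,w])$ for all $x,y,z,w\in\mathfrak g$. Let $\omega^\sharp:\mathfrak g\to\mathfrak g^*$ be given by $\omega^\sharp(x)(y)=\omega(x,y)$. On the complex of vector spaces $\mathfrak g^*\xrightarrow{(\omega^\sharp)^{-1}}\mathfrak g$ (with $V_1=\mathfrak g^*$, $V_0=\mathfrak g$) define a totally skew-symmetric $l_3$ by $$l_3(x,y,z)=[x,y,z],\quad l_3(x,y,\xi)=L^*_{x,y}\xi,\quad l_3(x,\xi,\eta)=0,\quad l_3(\xi,\eta,\gamma)=0$$ for all $x,y,z\in\mathfrak g$ and $\xi,\eta,\gamma\in\mathfrak g^*$, where $L_{x,y}z=\{x,y,z\}$ and $L^*$ is the dual representation of $L$, i.e. $\langle L^*_{x,y}\xi,z\rangle=-\langle\xi,\{x,y,z\}\rangle$. Then $(\mathfrak g^*,\mathfrak g,\mathrm d=(\omega^\sharp)^{-1},l_3)$ is a strict $3$-Lie $2$-algebra.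
   Context: A $3$-Lie algebra is a vector space $\mathfrak g$ with a linear map $[\cdot,\cdot,\cdot]:\wedge^3\mathfrak g\to\mathfrak g$ such that $[x_1,x_2,[x_3,x_4,x_5]]=[[x_1,x_2,x_3],x_4,x_5]+[x_3,[x_1,x_2,x_4],x_5]+[x_3,x_4,[x_1,x_2,x_5]]$. A symplectic structure on $(\mathfrak g,[\cdot,\cdot,\cdot])$ is a nondegenerate skew-symmetric bilinear form $\omega:\wedge^2\mathfrak g\to\mathbb R$ with $\omega([x,y,z],w)-\omega([x,y,w],z)+\omega([x,z,w],y)-\omega([y,z,w],x)=0$ for all $x,y,z,w\in\mathfrak g$. A $3$-pre-Lie algebra is a vector space $A$ with a trilinear map $\{\cdot,\cdot,\cdot\}$ such that, with $[x,y,z]_C=\{x,y,z\}+\{y,z,x\}+\{z,x,y\}$: $\{x,y,z\}=-\{y,x,z\}$; $\{x_1,x_2,\{x_3,x_4,x_5\}\}=\{[x_1,x_2,x_3]_C,x_4,x_5\}+\{x_3,[x_1,x_2,x_4]_C,x_5\}+\{x_3,x_4,\{x_1,x_2,x_5\}\}$; $\{[x_1,x_2,x_3]_C,x_4,x_5\}=\{x_1,x_2,\{x_3,x_4,x_5\}\}+\{x_2,x_3,\{x_1,x_4,x_5\}\}+\{x_3,x_1,\{x_2,x_4,x_5\}\}$. It is a known result that, for a symplectic structure $\omega$ on $(\mathfrak g,[\cdot,\cdot,\cdot])$, the formula for $\{\cdot,\cdot,\cdot\}$ in the claim defines a $3$-pre-Lie algebra with $[\cdot,\cdot,\cdot]_C=[\cdot,\cdot,\cdot]$,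 and that $L$ is a representation of the $3$-Lie algebra $\mathfrak g$ on $\mathfrak g$. (A representation of a $3$-Lie algebra $\mathfrak g$ on $V$ is a linear map $\rho:\wedge^2\mathfrak g\to\mathfrak{gl}(V)$ with $[\rho(x_1,x_2),\rho(y_1,y_2)]=\rho([x_1,x_2,y_1],y_2)+\rho(y_1,[x_1,x_2,y_2])$ and $\rho(x,[y_1,y_2,y_3])=\rho(y_2,y_3)\rho(x,y_1)-\rho(y_1,y_3)\rho(x,y_2)+\rho(y_1,y_2)\rho(x,y_3)$.) A strict $3$-Lie $2$-algebra (a $2$-term $3$-$Lie_\infty$-algebra with $l_5=0$) is a complex of vector spaces $V_1\xrightarrow{\mathrm d}V_0$ with completely skew-symmetric trilinear maps $l_3:V_i\times V_j\times V_k\to V_{i+j+k}$, $0\le i+j+k\le1$ (and $l_3$ is zero when two or more arguments are in $V_1$), such that for all $x,y,x_i\in V_0$, $f,g\in V_1$: (a) $\mathrm d l_3(x,y,f)=l_3(x,y,\mathrm df)$; (c) $l_3(\mathrm df,g,x)=l_3(f,\mathrm dg,x)$; (d) $l_3(x_1,x_2,l_3(x_3,x_4,x_5))=l_3(l_3(x_1,x_2,x_3),x_4,x_5)+l_3(x_3,l_3(x_1,x_2,x_4),x_5)+l_3(x_3,x_4,l_3(x_1,x_2,x_5))$; (e) $l_3(f,x_2,l_3(x_3,x_4,x_5))=l_3(l_3(f,x_2,x_3),x_4,x_5)+l_3(x_3,l_3(f,x_2,x_4),x_5)+l_3(x_3,x_4,l_3(f,x_2,x_5))$; (f) $l_3(x_1,x_2,l_3(f,x_4,x_5))=l_3(l_3(x_1,x_2,f),x_4,x_5)+l_3(f,l_3(x_1,x_2,x_4),x_5)+l_3(f,x_4,l_3(x_1,x_2,x_5))$.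 *)

theory Defs
  imports "HOL-Analysis.Analysis"
begin

section \<open>The algebraic dual of a real vector space\<close>

text \<open>The type \<open>'a dual\<close> is the space of all linear functionals on \<open>'a\<close>. No norm is involved,
  unlike for the type of bounded linear functionals of the library.\<close>

typedef (overloaded) 'a dual = "{f :: 'a::real_vector \<Rightarrow> real. linear f}"
  morphisms dual_apply Dual
  by (auto intro: linear_zero)

lemma linear_dual_apply: "linear (dual_apply \<xi>)"
  using dual_apply [of \<xi>] by simp

lemma dual_apply_Dual: "linear f \<Longrightarrow> dual_apply (Dual f) = f"
  by (simp add: Dual_inverse)

lemma dual_eqI: "(\<And>x. dual_apply \<xi> x = dual_apply \<eta> x) \<Longrightarrow> \<xi> = \<eta>"
  by (metis dual_apply_inject ext)

instantiation dual :: (real_vector) real_vector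
begin

definition "0 = Dual (\<lambda>x. 0)"
definition "- \<xi> = Dual (\<lambda>x. - dual_apply \<xi> x)"
definition "\<xi> + \<eta> = Dual (\<lambda>x. dual_apply \<xi> x + dual_apply \<eta> x)"
definition "\<xi> - \<eta> = Dual (\<lambda>x. dual_apply \<xi> x - dual_apply \<eta> x)"
definition "c *\<^sub>R \<xi> = Dual (\<lambda>x. c *\<^sub>R dual_apply \<xi> x)"

lemma dual_apply_simps [simp]:
  "dual_apply 0 x = 0"
  "dual_apply (- \<xi>) x = - dual_apply \<xi> x"
  "dual_apply (\<xi> + \<eta>) x = dual_apply \<xi> x + dual_apply \<eta> x"
  "dual_apply (\<xi> - \<eta>) x = dual_apply \<xi> x - dual_apply \<eta> x"
  "dual_apply (c *\<^sub>R \<xi>) x = c * dual_apply \<xi> x"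
  by (simp_all add: zero_dual_def uminus_dual_def plus_dual_def minus_dual_def scaleR_dual_def
      dual_apply_Dual linear_zero linear_compose_neg linear_compose_add linear_compose_sub
      linear_compose_scale_right linear_dual_apply del: real_scaleR_def)
    simp

instance
  by standard (auto intro!: dual_eqI simp: algebra_simps)

end


section \<open>3-Lie algebras, symplectic structures, 3-pre-Lie algebras\<close>

definition trilinear ::
  "('a::real_vector \<Rightarrow> 'b::real_vector \<Rightarrow> 'c::real_vector \<Rightarrow> 'd::real_vector) \<Rightarrow> bool" where
  "trilinear f \<longleftrightarrow>
     (\<forall>y z. linear (\<lambda>x. f x y z)) \<and> (\<forall>x z. linear (\<lambda>y. f x y z)) \<and> (\<forall>x y. linear (f x y))"

text \<open>The two adjacent transpositions generate the symmetric group on three letters.\<close>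

definition skew3 :: "('a \<Rightarrow> 'a \<Rightarrow> 'a \<Rightarrow> 'b::real_vector) \<Rightarrow> bool" where
  "skew3 f \<longleftrightarrow> (\<forall>x y z. f y x z = - f x y z) \<and> (\<forall>x y z. f x z y = - f x y z)"

locale three_lie_algebra =
  fixes br :: "'a::real_vector \<Rightarrow> 'a \<Rightarrow> 'a \<Rightarrow> 'a"
  assumes trilinear: "trilinear br"
    and skew: "skew3 br"
    and fundamental_identity:
      "br x1 x2 (br x3 x4 x5) =
         br (br x1 x2 x3) x4 x5 + br x3 (br x1 x2 x4) x5 + br x3 x4 (br x1 x2 x5)"

locale symplectic_structure =
  fixes br :: "'a::real_vector \<Rightarrow> 'a \<Rightarrow> 'a \<Rightarrow> 'a" and \<omega> :: "'a \<Rightarrow> 'a \<Rightarrow> real"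
  assumes bilinear: "bilinear \<omega>"
    and skew: "\<omega> y x = - \<omega> x y"
    and nondegenerate: "(\<forall>y. \<omega> x y = 0) \<Longrightarrow> x = 0"
    and closed:
      "\<omega> (br x y z) w - \<omega> (br x y w) z + \<omega> (br x z w) y - \<omega> (br y z w) x = 0"

definition commutator3 :: "('a::real_vector \<Rightarrow> 'a \<Rightarrow> 'a \<Rightarrow> 'a) \<Rightarrow> 'a \<Rightarrow> 'a \<Rightarrow> 'a \<Rightarrow> 'a" where
  "commutator3 pl x y z = pl x y z + pl y z x + pl z x y"

locale three_pre_lie_algebra =
  fixes pl :: "'a::real_vector \<Rightarrow> 'a \<Rightarrow> 'a \<Rightarrow> 'a"
  assumes trilinear: "trilinear pl"
    and skew: "pl x y z = - pl y x z"
    and pre_lie_1: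
      "pl x1 x2 (pl x3 x4 x5) =
         pl (commutator3 pl x1 x2 x3) x4 x5 + pl x3 (commutator3 pl x1 x2 x4) x5
           + pl x3 x4 (pl x1 x2 x5)"
    and pre_lie_2:
      "pl (commutator3 pl x1 x2 x3) x4 x5 =
         pl x1 x2 (pl x3 x4 x5) + pl x2 x3 (pl x1 x4 x5) + pl x3 x1 (pl x2 x4 x5)"


section \<open>Strict 3-Lie 2-algebras\<close>

text \<open>A graded map \<open>l\<^sub>3\<close> with components \<open>V\<^sub>i \<times> V\<^sub>j \<times> V\<^sub>k \<rightarrow> V\<^bsub>i+j+k\<^esub>\<close> is a degree-preserving trilinear
  map on the direct sum \<open>V\<^sub>0 \<oplus> V\<^sub>1\<close>, here the product type \<open>'v0 \<times> 'v1\<close>. The degree conditions below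
  list one order of arguments each; skew-symmetry yields the others.\<close>

abbreviation deg0 :: "'v0 \<Rightarrow> 'v0 \<times> 'v1::zero" where "deg0 x \<equiv> (x, 0)"

abbreviation deg1 :: "'v1 \<Rightarrow> 'v0::zero \<times> 'v1" where "deg1 f \<equiv> (0, f)"

locale strict_three_lie_two_algebra =
  fixes d :: "'v1::real_vector \<Rightarrow> 'v0::real_vector"
    and l3 :: "'v0 \<times> 'v1 \<Rightarrow> 'v0 \<times> 'v1 \<Rightarrow> 'v0 \<times> 'v1 \<Rightarrow> 'v0 \<times> 'v1"
  assumes linear_d: "linear d"
    and trilinear: "trilinear l3"
    and skew: "skew3 l3"
    and degree_000: "snd (l3 (deg0 x) (deg0 y) (deg0 z)) = 0"
    and degree_001: "fst (l3 (deg0 x) (deg0 y) (deg1 f)) = 0"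
    and degree_011: "l3 (deg0 x) (deg1 f) (deg1 g) = 0"
    and degree_111: "l3 (deg1 f) (deg1 g) (deg1 h) = 0"
    and cond_a: "deg0 (d (snd (l3 (deg0 x) (deg0 y) (deg1 f)))) = l3 (deg0 x) (deg0 y) (deg0 (d f))"
    and cond_c: "l3 (deg0 (d f)) (deg1 g) (deg0 x) = l3 (deg1 f) (deg0 (d g)) (deg0 x)"
    and cond_d:
      "l3 (deg0 x1) (deg0 x2) (l3 (deg0 x3) (deg0 x4) (deg0 x5)) =
         l3 (l3 (deg0 x1) (deg0 x2) (deg0 x3)) (deg0 x4) (deg0 x5)
           + l3 (deg0 x3) (l3 (deg0 x1) (deg0 x2) (deg0 x4)) (deg0 x5)
           + l3 (deg0 x3) (deg0 x4) (l3 (deg0 x1) (deg0 x2) (deg0 x5))"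
    and cond_e:
      "l3 (deg1 f) (deg0 x2) (l3 (deg0 x3) (deg0 x4) (deg0 x5)) =
         l3 (l3 (deg1 f) (deg0 x2) (deg0 x3)) (deg0 x4) (deg0 x5)
           + l3 (deg0 x3) (l3 (deg1 f) (deg0 x2) (deg0 x4)) (deg0 x5)
           + l3 (deg0 x3) (deg0 x4) (l3 (deg1 f) (deg0 x2) (deg0 x5))"
    and cond_f:
      "l3 (deg0 x1) (deg0 x2) (l3 (deg1 f) (deg0 x4) (deg0 x5)) =
         l3 (l3 (deg0 x1) (deg0 x2) (deg1 f)) (deg0 x4) (deg0 x5)
           + l3 (deg1 f) (l3 (deg0 x1) (deg0 x2) (deg0 x4)) (deg0 x5)
           + l3 (deg1 f) (deg0 x4) (l3 (deg0 x1) (deg0 x2) (deg0 x5))"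


section \<open>The structure induced by a symplectic 3-Lie algebra\<close>

definition \<omega>_sharp :: "('a::real_vector \<Rightarrow> 'a \<Rightarrow> real) \<Rightarrow> 'a \<Rightarrow> 'a dual" where
  "\<omega>_sharp \<omega> x = Dual (\<omega> x)"

definition dual_action :: "('a \<Rightarrow> 'a \<Rightarrow> 'v \<Rightarrow> 'v) \<Rightarrow> 'a \<Rightarrow> 'a \<Rightarrow> 'v::real_vector dual \<Rightarrow> 'v dual" where
  "dual_action \<rho> x y \<xi> = Dual (\<lambda>z. - dual_apply \<xi> (\<rho> x y z))"

text \<open>The second component is the only totally skew-symmetric trilinear map that sends
  \<open>(x, y, \<xi>)\<close> to \<open>L\<^sup>*\<^bsub>x,y\<^esub> \<xi>\<close> and vanishes when no or several arguments lie in the dual; moving \<open>\<xi>\<close> to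
  another position by a cyclic permutation does not change the sign.\<close>

definition l3_of :: "('a::real_vector \<Rightarrow> 'a \<Rightarrow> 'a \<Rightarrow> 'a) \<Rightarrow> ('a \<Rightarrow> 'a \<Rightarrow> 'a \<Rightarrow> 'a) \<Rightarrow>
    'a \<times> 'a dual \<Rightarrow> 'a \<times> 'a dual \<Rightarrow> 'a \<times> 'a dual \<Rightarrow> 'a \<times> 'a dual" where
  "l3_of br pl = (\<lambda>(x, \<xi>) (y, \<eta>) (z, \<zeta>).
     (br x y z, dual_action pl x y \<zeta> + dual_action pl y z \<xi> + dual_action pl z x \<eta>))"

lemma dual_apply_\<omega>_sharp:
  assumes "symplectic_structure br \<omega>"
  shows "dual_apply (\<omega>_sharp \<omega> x) y = \<omega> x y"
  using symplectic_structure.bilinear [OF assms]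
  by (simp add: \<omega>_sharp_def bilinear_def dual_apply_Dual)

lemma dual_apply_dual_action:
  assumes "linear (\<rho> x y)"
  shows "dual_apply (dual_action \<rho> x y \<xi>) z = - dual_apply \<xi> (\<rho> x y z)"
proof -
  have "linear (\<lambda>z. - dual_apply \<xi> (\<rho> x y z))"
    using linear_compose [OF assms linear_dual_apply [of \<xi>]]
    by (intro linear_compose_neg) (simp add: o_def)
  then show ?thesis
    by (simp add: dual_action_def dual_apply_Dual)
qed

lemma l3_of_simps:
  assumes "trilinear br" and "trilinear pl"
  shows "l3_of br pl (deg0 x) (deg0 y) (deg0 z) = deg0 (br x y z)"
    and "l3_of br pl (deg0 x) (deg0 y) (deg1 \<xi>) = deg1 (dual_action pl x y \<xi>)"
    and "l3_of br pl (deg0 x) (deg1 \<xi>) (deg1 \<eta>) = 0"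
    and "l3_of br pl (deg1 \<xi>) (deg1 \<eta>) (deg1 \<gamma>) = 0"
proof -
  have br0: "br x y 0 = 0" "br x 0 z = 0" "br 0 y z = 0" for x y z
    using assms(1) unfolding trilinear_def by (metis linear_0)+
  have pl0: "pl x 0 z = 0" "pl 0 y z = 0" for x y z
    using assms(2) unfolding trilinear_def by (metis linear_0)+
  have act0: "dual_action pl x y 0 = 0" "dual_action pl x 0 \<xi> = 0" "dual_action pl 0 y \<xi> = 0"
    for x y \<xi>
    by (auto simp: dual_action_def zero_dual_def pl0 linear_0 [OF linear_dual_apply]
        simp flip: zero_dual_def)
  show "l3_of br pl (deg0 x) (deg0 y) (deg0 z) = deg0 (br x y z)"
    and "l3_of br pl (deg0 x) (deg0 y) (deg1 \<xi>) = deg1 (dual_action pl x y \<xi>)"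
    and "l3_of br pl (deg0 x) (deg1 \<xi>) (deg1 \<eta>) = 0"
    and "l3_of br pl (deg1 \<xi>) (deg1 \<eta>) (deg1 \<gamma>) = 0"
    by (simp_all add: l3_of_def br0 act0 zero_prod_def)
qed

lemma bij_\<omega>_sharp:
  fixes \<omega> :: "'a::real_vector \<Rightarrow> 'a \<Rightarrow> real"
  assumes fin: "\<exists>B :: 'a set. finite B \<and> span B = UNIV" and \<omega>: "symplectic_structure br \<omega>"
  shows "linear (\<omega>_sharp \<omega>)" and "bij (\<omega>_sharp \<omega>)"
proof -
  interpret symplectic_structure br \<omega> by fact
  note sharp = dual_apply_\<omega>_sharp [OF \<omega>]
  show lin: "linear (\<omega>_sharp \<omega>)"
    using bilinear by (auto intro!: linearI dual_eqI simp: sharp bilinear_ladd bilinear_lmul)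
  have inj: "inj (\<omega>_sharp \<omega>)"
    unfolding linear_injective_0 [OF lin]
  proof (intro allI impI)
    fix x assume "\<omega>_sharp \<omega> x = 0"
    then have "\<omega> x y = 0" for y
      using sharp [of x y] by simp
    then show "x = 0"
      using nondegenerate by blast
  qed
  obtain S :: "'a set" where S: "finite S" "span S = UNIV"
    using fin by blast
  obtain B where B: "B \<subseteq> S" "independent B" "S \<subseteq> span B"
    using maximal_independent_subset [of S] by blast
  have finB: "finite B"
    using B S finite_subset by blast
  have spanB: "span B = UNIV"
    using span_mono [OF B(3)] S(2) by (simp add: span_span top.extremum_unique)
  interpret V: finite_dimensional_vector_space "scaleR :: real \<Rightarrow> 'a \<Rightarrow> 'a" B
    using finB B(2) spanB
    by unfold_locales (simp_all add: dependent_raw_def span_raw_def)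
  define \<phi> :: "'a dual \<Rightarrow> 'a" where "\<phi> \<xi> = (\<Sum>b\<in>B. dual_apply \<xi> b *\<^sub>R b)" for \<xi>
  have lin\<phi>: "linear \<phi>"
    by (intro linearI)
      (simp_all add: \<phi>_def scaleR_add_left sum.distrib scaleR_sum_right)
  have inj\<phi>: "inj \<phi>"
    unfolding linear_injective_0 [OF lin\<phi>]
  proof (intro allI impI)
    fix \<xi> assume "\<phi> \<xi> = 0"
    then have "\<forall>b\<in>B. dual_apply \<xi> b = 0"
      using independentD [OF B(2) finB order_refl] unfolding \<phi>_def by blast
    then show "\<xi> = 0"
      using linear_eq_0_on_span [OF linear_dual_apply [of \<xi>], of B] spanB
      by (intro dual_eqI) auto
  qed
  have "linear (\<phi> \<circ> \<omega>_sharp \<omega>)" "inj (\<phi> \<circ> \<omega>_sharp \<omega>)"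
    by (rule linear_compose [OF lin lin\<phi>], rule inj_compose [OF inj\<phi> inj])
  then have "surj (\<phi> \<circ> \<omega>_sharp \<omega>)"
    by (intro V.linear_inj_imp_surj) (simp_all only: linear_def)
  then have "\<exists>x. \<phi> \<xi> = \<phi> (\<omega>_sharp \<omega> x)" for \<xi>
    unfolding surj_def o_def by blast
  then have "surj (\<omega>_sharp \<omega>)"
    unfolding surj_def using injD [OF inj\<phi>] by blast
  with inj show "bij (\<omega>_sharp \<omega>)"
    by (simp add: bij_def)
qed

lemma induced_pre_lie_ex1:
  fixes \<omega> :: "'a::real_vector \<Rightarrow> 'a \<Rightarrow> real"
  assumes fin: "\<exists>B :: 'a set. finite B \<and> span B = UNIV"
    and br: "three_lie_algebra br" and \<omega>: "symplectic_structure br \<omega>"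
  shows "\<exists>!pl. \<forall>x y z w. \<omega> (pl x y z) w = - \<omega> z (br x y w)"
proof -
  interpret three_lie_algebra br by fact
  interpret S: symplectic_structure br \<omega> by fact
  note sharp = dual_apply_\<omega>_sharp [OF \<omega>]
  have "\<exists>!u. \<forall>w. \<omega> u w = - \<omega> z (br x y w)" for x y z
  proof -
    have lin: "linear (\<lambda>w. - \<omega> z (br x y w))"
    proof -
      have "linear (br x y)" "linear (\<omega> z)"
        using trilinear S.bilinear by (auto simp: trilinear_def bilinear_def)
      from linear_compose [OF this] show ?thesis
        by (intro linear_compose_neg) (simp add: o_def)
    qed
    have "\<exists>!u. \<omega>_sharp \<omega> u = Dual (\<lambda>w. - \<omega> z (br x y w))"
      using bij_\<omega>_sharp(2) [OF fin \<omega>] by (metis bij_pointE)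
    moreover have "\<omega>_sharp \<omega> u = Dual (\<lambda>w. - \<omega> z (br x y w)) \<longleftrightarrow>
        (\<forall>w. \<omega> u w = - \<omega> z (br x y w))" for u
      by (metis dual_apply_Dual [OF lin] sharp dual_eqI)
    ultimately show ?thesis
      by simp
  qed
  then have ex1: "\<exists>!u. \<forall>w. \<omega> u w = - \<omega> z (br x y w)" for x y z .
  define f where "f x y z = (THE u. \<forall>w. \<omega> u w = - \<omega> z (br x y w))" for x y z
  have f: "\<omega> (f x y z) w = - \<omega> z (br x y w)" for x y z w
    using theI' [OF ex1 [of z x y]] unfolding f_def by blast
  show ?thesis
  proof
    show "\<forall>x y z w. \<omega> (f x y z) w = - \<omega> z (br x y w)"
      using f by blast
    show "pl = f" if "\<forall>x y z w. \<omega> (pl x y z) w = - \<omega> z (br x y w)" for pl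
    proof (intro ext)
      fix x y z
      show "pl x y z = f x y z"
        using ex1 [of z x y] that f by blast
    qed
  qed
qed

lemma eliminate_aux:
  fixes a :: "'a::real_vector"
  assumes 1: "a = 3 *\<^sub>R a + e + b" and 2: "b = 2 *\<^sub>R e + a"
  shows "a = - b"
proof -
  have n: "3 *\<^sub>R v = v + v + v" "6 *\<^sub>R v = v + v + v + v + v + v" for v :: 'a
    using scaleR_add_left [of 2 1 v] scaleR_add_left [of 3 3 v] by (simp_all add: scaleR_2)
  have "a - (3 *\<^sub>R a + e + b) = 0" "2 *\<^sub>R e + a - b = 0"
    using 1 2 by (metis diff_self)+
  then have "2 *\<^sub>R (a - (3 *\<^sub>R a + e + b)) + (2 *\<^sub>R e + a - b) = 0"
    by (simp only: scaleR_zero_right add_0_right)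
  also have "2 *\<^sub>R (a - (3 *\<^sub>R a + e + b)) + (2 *\<^sub>R e + a - b) = - 3 *\<^sub>R (a + b)"
    by (simp add: algebra_simps scaleR_2 n)
  finally show ?thesis
    by (simp add: eq_neg_iff_add_eq_0)
qed

lemma three_pre_lie_induced:
  assumes br: "three_lie_algebra br" and \<omega>: "symplectic_structure br \<omega>"
    and pl: "\<forall>x y z w. \<omega> (pl x y z) w = - \<omega> z (br x y w)"
  shows "three_pre_lie_algebra pl" and "commutator3 pl = br"
proof -
  interpret three_lie_algebra br by fact
  interpret S: symplectic_structure br \<omega> by fact
  note pl = pl [rule_format]
  note lsimps = bilinear_ladd [OF S.bilinear] bilinear_radd [OF S.bilinear]
    bilinear_lmul [OF S.bilinear] bilinear_rmul [OF S.bilinear]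
    bilinear_lneg [OF S.bilinear] bilinear_rneg [OF S.bilinear]
  have eqI: "u = v" if "\<And>w. \<omega> u w = \<omega> v w" for u v
    using S.nondegenerate [of "u - v"] that by (simp add: bilinear_lsub [OF S.bilinear])
  have brs: "br y x z = - br x y z" "br x z y = - br x y z" for x y z
    using skew unfolding skew3_def by blast+
  have brc: "br x y z = br y z x" for x y z
    using brs [of y z x] brs [of x y z] brs [of x z y] by (metis brs minus_minus)
  have brlin: "linear (\<lambda>x. br x y z)" "linear (\<lambda>y. br x y z)" "linear (br x y)" for x y z
    using trilinear by (auto simp: trilinear_def)
  note bradd = brlin [THEN linear_add] and brscale = brlin [THEN linear_scale]
  have comm: "commutator3 pl x y z = br x y z" for x y z
  proof (rule eqI)
    fix w
    show "\<omega> (commutator3 pl x y z) w = \<omega> (br x y z) w"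
      using S.closed [of x y z w] S.skew [of "br x y w" z] S.skew [of "br x z w" y]
        S.skew [of "br y z w" x] brs(1) [of x z w] S.skew [of "br z x w" y]
      by (simp add: commutator3_def lsimps pl)
  qed
  then show "commutator3 pl = br"
    by (simp add: fun_eq_iff)
  have plsub: "pl (br x1 x2 x3) x4 x5 =
      pl x1 x2 (pl x3 x4 x5) + pl x2 x3 (pl x1 x4 x5) + pl x3 x1 (pl x2 x4 x5)"
    if "\<And>w. br (br x1 x2 x3) x4 w = - (br x3 x4 (br x1 x2 w) + br x1 x4 (br x2 x3 w)
        + br x2 x4 (br x3 x1 w)) "
    for x1 x2 x3 x4 x5
    by (rule eqI) (simp add: lsimps pl that bilinear_rsub [OF S.bilinear])
  show "three_pre_lie_algebra pl"
  proof
    show "trilinear pl"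
      unfolding trilinear_def
      by (intro conjI allI linearI; rule eqI) (simp_all add: lsimps pl bradd brscale)
    show "pl x y z = - pl y x z" for x y z
      by (rule eqI) (simp add: lsimps pl brs(1) [of x y])
    show "pl x1 x2 (pl x3 x4 x5) =
        pl (commutator3 pl x1 x2 x3) x4 x5 + pl x3 (commutator3 pl x1 x2 x4) x5
          + pl x3 x4 (pl x1 x2 x5)" for x1 x2 x3 x4 x5
      unfolding comm
      by (rule eqI) (simp add: lsimps pl fundamental_identity [of x1 x2 x3 x4])
    show "pl (commutator3 pl x1 x2 x3) x4 x5 =
        pl x1 x2 (pl x3 x4 x5) + pl x2 x3 (pl x1 x4 x5) + pl x3 x1 (pl x2 x4 x5)"
      for x1 x2 x3 x4 x5
      unfolding comm
    proof (rule plsub)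
      fix w
      show "br (br x1 x2 x3) x4 w = - (br x3 x4 (br x1 x2 w) + br x1 x4 (br x2 x3 w)
        + br x2 x4 (br x3 x1 w))"
      proof -
        have scaleR_3: "3 *\<^sub>R v = v + v + v" for v :: 'a
          using scaleR_add_left [of 2 1 v] by (simp add: scaleR_2)
        define A where "A = br x1 x2 (br x3 x4 w) + br x2 x3 (br x1 x4 w) + br x3 x1 (br x2 x4 w)"
        define B where "B = br x3 x4 (br x1 x2 w) + br x1 x4 (br x2 x3 w) + br x2 x4 (br x3 x1 w)"
        define E where "E = br (br x2 x4 x3) x1 w + br (br x3 x4 x1) x2 w + br (br x1 x4 x2) x3 w"
        let ?c = "br (br x1 x2 x3) x4 w"
        have s1: "br b (br p q r) w = br (br p r q) b w" for b p q r
          using brs(1) [of b "br p q r" w] brs(2) [of p r q] linear_neg [OF brlin(1)]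
          by simp
        have s2: "br b (br p q r) w = br (br r q p) b w" for b p q r
          unfolding brc [of p r q, symmetric] by (rule s1)
        have c: "?c = A"
          using fundamental_identity [of x4 w x1 x2 x3]
          unfolding A_def
          by (simp add: brc [of "br x1 x2 x3" x4 w, symmetric] brc [of x1 x4 w, symmetric] brc [of x2 x4 w, symmetric]
              brc [of x3 x4 w, symmetric] brc [of "br x1 x4 w" x2 x3]
              brc [of x3 x1 "br x2 x4 w", symmetric] add_ac)
        have a: "A = 3 *\<^sub>R ?c + E + B"
          using fundamental_identity [of x1 x2 x3 x4 w] fundamental_identity [of x2 x3 x1 x4 w]
            fundamental_identity [of x3 x1 x2 x4 w]
          unfolding A_def B_def E_def
          by (simp add: scaleR_3 s1 [of x3 x1 x2 x4] s1 [of x1 x2 x3 x4] s1 [of x2 x3 x1 x4]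
              brc [of x1 x2 x3, symmetric] brc [of x3 x1 x2] add_ac)
        have b: "B = 2 *\<^sub>R E + A"
          using fundamental_identity [of x3 x4 x1 x2 w] fundamental_identity [of x1 x4 x2 x3 w]
            fundamental_identity [of x2 x4 x3 x1 w]
          unfolding A_def B_def E_def
          by (simp add: scaleR_2 s2 [of x1 x3 x4 x2] s2 [of x2 x1 x4 x3] s2 [of x3 x2 x4 x1] add_ac)
        have "?c = - B"
          using trans [OF c a] b [folded c] by (rule eliminate_aux)
        then show ?thesis
          by (simp only: B_def)
      qed
    qed
  qed
qed

end

(* Nondegeneracy identifies the dual with g through \<omega>_sharp, and skew-symmetry of \<omega> turns the
   defining relation of pl into L*_{x,y} \<omega>_sharp(u) = \<omega>_sharp([x,y,u]). Thus the dual representation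
   of L is the adjoint representation, d becomes the identity, and each condition on l3 is either
   the cyclic symmetry of the bracket or an instance of its fundamental identity. *)

theory Submission
  imports Defs
begin

context three_lie_algebra
begin

lemma br_add:
  "br (x + x') y z = br x y z + br x' y z"
  "br x (y + y') z = br x y z + br x y' z"
  "br x y (z + z') = br x y z + br x y z'"
  using trilinear unfolding trilinear_def by (blast dest: linear_add)+

lemma br_scale:
  "br (c *\<^sub>R x) y z = c *\<^sub>R br x y z"
  "br x (c *\<^sub>R y) z = c *\<^sub>R br x y z"
  "br x y (c *\<^sub>R z) = c *\<^sub>R br x y z"
  using trilinear unfolding trilinear_def by (blast dest: linear_scale)+

lemma br_zero: "br 0 y z = 0" "br x 0 z = 0" "br x y 0 = 0"
  using br_scale [where c = 0] by (metis scaleR_zero_left)+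

lemma br_swap: "br y x z = - br x y z" "br x z y = - br x y z"
  using skew unfolding skew3_def by blast+

text \<open>A 3-cycle is an even permutation, so a chosen argument can be rotated into any slot
  without a sign.\<close>

lemma br_cyclic: "br x y z = br y z x"
  by (metis br_swap minus_minus)

end

text \<open>Evaluated at \<open>z\<close>, two uses of skew-symmetry around the defining relation of
  \<open>pl\<close> carry \<open>- \<omega> u (pl x y z)\<close> through
  \<open>\<omega> (pl x y z) u\<close> and \<open>- \<omega> z (br x y u)\<close> to
  \<open>\<omega> (br x y u) z\<close>.\<close>

lemma dual_action_\<omega>_sharp:
  assumes \<omega>: "symplectic_structure br \<omega>"
    and pl: "\<forall>x y z w. \<omega> (pl x y z) w = - \<omega> z (br x y w)"
    and lin: "linear (pl x y)"
  shows "dual_action pl x y (\<omega>_sharp \<omega> u) = \<omega>_sharp \<omega> (br x y u)"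
proof (rule dual_eqI)
  interpret symplectic_structure br \<omega> by fact
  fix z
  have "- \<omega> u (pl x y z) = \<omega> (br x y u) z"
    using pl skew by (metis minus_minus)
  then show "dual_apply (dual_action pl x y (\<omega>_sharp \<omega> u)) z
      = dual_apply (\<omega>_sharp \<omega> (br x y u)) z"
    by (simp add: dual_apply_dual_action lin dual_apply_\<omega>_sharp [OF \<omega>])
qed

text \<open>In these coordinates \<open>l3_of br pl\<close> is the bracket extended to the dual
  numbers: up to cyclic rotation, the sum under \<open>\<omega>_sharp \<omega>\<close> is the
  \<epsilon>-coefficient of the bracket of x + \<epsilon>u, y + \<epsilon>v, z + \<epsilon>w, where
  \<epsilon> has square zero.\<close>

lemma l3_of_\<omega>_sharp:
  assumes br: "three_lie_algebra br" and \<omega>: "symplectic_structure br \<omega>"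
    and pl: "\<forall>x y z w. \<omega> (pl x y z) w = - \<omega> z (br x y w)"
    and lin: "linear (\<omega>_sharp \<omega>)"
  shows "l3_of br pl (x, \<omega>_sharp \<omega> u) (y, \<omega>_sharp \<omega> v) (z, \<omega>_sharp \<omega> w)
    = (br x y z, \<omega>_sharp \<omega> (br x y w + br y z u + br z x v))"
proof -
  \<comment> \<open>\<open>pl\<close> is given only through its defining relation; its linearity
    comes from the induced 3-pre-Lie structure.\<close>
  interpret three_pre_lie_algebra pl
    using three_pre_lie_induced(1) [OF br \<omega> pl] .
  have "linear (pl a b)" for a b
    using trilinear by (simp add: trilinear_def)
  then show ?thesis
    by (simp add: l3_of_def dual_action_\<omega>_sharp [OF \<omega> pl] linear_add [OF lin])
qed

theorem theorem5p10:
  fixes br pl :: "'a::real_vector \<Rightarrow> 'a \<Rightarrow> 'a \<Rightarrow> 'a" and \<omega> :: "'a \<Rightarrow> 'a \<Rightarrow> real"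
  assumes "\<exists>B :: 'a set. finite B \<and> span B = UNIV"
    and "three_lie_algebra br"
    and "symplectic_structure br \<omega>"
    and "\<forall>x y z w. \<omega> (pl x y z) w = - \<omega> z (br x y w)"
  shows "strict_three_lie_two_algebra (inv (\<omega>_sharp \<omega>)) (l3_of br pl)"
proof -
  interpret three_lie_algebra br by fact
  let ?s = "\<omega>_sharp \<omega>" and ?d = "inv (\<omega>_sharp \<omega>)"
  note lin = bij_\<omega>_sharp(1) [OF assms(1,3)] and bij = bij_\<omega>_sharp(2) [OF assms(1,3)]
  have ds: "?d (?s u) = u" and sd: "?s (?d \<xi>) = \<xi>" for u \<xi>
    using bij by (simp_all add: bij_is_inj bij_is_surj surj_f_inv_f)
  note s_add = linear_add [OF lin] and s_scale = linear_scale [OF lin]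
    and s_neg = linear_neg [OF lin]
  have s0: "?s 0 = 0"
    by (rule linear_0 [OF lin])
  have lind: "linear ?d"
  proof (rule linearI)
    show "?d (\<xi> + \<eta>) = ?d \<xi> + ?d \<eta>" for \<xi> \<eta>
      using ds [of "?d \<xi> + ?d \<eta>"] by (simp add: s_add sd)
    show "?d (c *\<^sub>R \<xi>) = c *\<^sub>R ?d \<xi>" for c \<xi>
      using ds [of "c *\<^sub>R ?d \<xi>"] by (simp add: s_scale sd)
  qed
  note d_simps = linear_add [OF lind] linear_scale [OF lind] linear_0 [OF lind]
  \<comment> \<open>Every functional is \<open>?s\<close> of its image under \<open>?d\<close>, so
    from here on only brackets of vectors occur.\<close>
  have l3: "l3_of br pl (x, \<xi>) (y, \<eta>) (z, \<zeta>)
      = (br x y z, ?s (br x y (?d \<zeta>) + br y z (?d \<xi>) + br z x (?d \<eta>)))" for x y z \<xi> \<eta> \<zeta>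
    using l3_of_\<omega>_sharp [OF assms(2-4) lin, of x "?d \<xi>" y "?d \<eta>" z "?d \<zeta>"] by (simp add: sd)
  show ?thesis
  proof (rule strict_three_lie_two_algebra.intro)
    show "linear ?d"
      by (rule lind)
    show "trilinear (l3_of br pl)"
      \<comment> \<open>Reading \<open>s_add\<close> and \<open>s_scale\<close> backwards gathers
        the second components under one \<open>?s\<close>, where trilinearity of \<open>br\<close>
        decides.\<close>
      unfolding trilinear_def
      by (intro conjI allI linearI)
        (auto simp: l3 br_add br_scale d_simps scaleR_add_right add_ac
          simp flip: s_add s_scale)
    show "skew3 (l3_of br pl)"
    proof -
      have "l3_of br pl q p r = - l3_of br pl p q r \<and> l3_of br pl p r q = - l3_of br pl p q r"
        for p q r
      proof (cases p, cases q, cases r)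
        fix x \<xi> y \<eta> z \<zeta>
        assume pqr: "p = (x, \<xi>)" "q = (y, \<eta>)" "r = (z, \<zeta>)"
        \<comment> \<open>An adjacent transposition permutes the three summands and reverses the
          sign of each; \<open>u\<close>, \<open>v\<close>, \<open>w\<close> stand for the images of
          \<open>\<xi>\<close>, \<open>\<eta>\<close>, \<open>\<zeta>\<close> under
          \<open>?d\<close>.\<close>
        have "br y x w + br x z v + br z y u = - (br x y w + br y z u + br z x v)"
          "br x z v + br z y u + br y x w = - (br x y w + br y z u + br z x v)" for u v w
          by (simp_all add: br_swap(1) [of y x] br_swap(1) [of z y] br_swap(1) [of x z])
        then show ?thesis
          by (simp only: pqr l3 uminus_Pair s_neg br_swap(1) [of y x z]
              br_swap(2) [of x z y] simp_thms)
      qed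
      then show ?thesis
        unfolding skew3_def by blast
    qed
    show "snd (l3_of br pl (deg0 x) (deg0 y) (deg0 z)) = 0" for x y z
      by (simp add: l3 br_zero d_simps s0)
    show "fst (l3_of br pl (deg0 x) (deg0 y) (deg1 f)) = 0" for x y f
      by (simp add: l3 br_zero)
    show "l3_of br pl (deg0 x) (deg1 f) (deg1 g) = 0" for x f g
      by (simp add: l3 br_zero s0 zero_prod_def)
    show "l3_of br pl (deg1 f) (deg1 g) (deg1 h) = 0" for f g h
      by (simp add: l3 br_zero s0 zero_prod_def)
    show "deg0 (?d (snd (l3_of br pl (deg0 x) (deg0 y) (deg1 f))))
        = l3_of br pl (deg0 x) (deg0 y) (deg0 (?d f))" for x y f
      by (simp add: l3 br_zero d_simps s0 ds)
    show "l3_of br pl (deg0 (?d f)) (deg1 g) (deg0 x) = l3_of br pl (deg1 f) (deg0 (?d g)) (deg0 x)"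
      for f g x
      \<comment> \<open>The two sides are \<open>?s\<close> of \<open>br x (?d f) (?d g)\<close> and
        of \<open>br (?d g) x (?d f)\<close>, which are cyclic rotations of each other.\<close>
      by (simp add: l3 br_zero d_simps s0 br_cyclic [of x "?d f"] br_cyclic [of "?d f"])
    fix x1 x2 x3 x4 x5 f
    let ?u = "?d f"
    show "l3_of br pl (deg0 x1) (deg0 x2) (l3_of br pl (deg0 x3) (deg0 x4) (deg0 x5)) =
         l3_of br pl (l3_of br pl (deg0 x1) (deg0 x2) (deg0 x3)) (deg0 x4) (deg0 x5)
           + l3_of br pl (deg0 x3) (l3_of br pl (deg0 x1) (deg0 x2) (deg0 x4)) (deg0 x5)
           + l3_of br pl (deg0 x3) (deg0 x4) (l3_of br pl (deg0 x1) (deg0 x2) (deg0 x5))"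
      by (simp add: l3 br_zero d_simps s0 flip: fundamental_identity)
    show "l3_of br pl (deg1 f) (deg0 x2) (l3_of br pl (deg0 x3) (deg0 x4) (deg0 x5)) =
         l3_of br pl (l3_of br pl (deg1 f) (deg0 x2) (deg0 x3)) (deg0 x4) (deg0 x5)
           + l3_of br pl (deg0 x3) (l3_of br pl (deg1 f) (deg0 x2) (deg0 x4)) (deg0 x5)
           + l3_of br pl (deg0 x3) (deg0 x4) (l3_of br pl (deg1 f) (deg0 x2) (deg0 x5))"
      \<comment> \<open>The functional enters as the first argument of the identity; rotations bring
        its terms to the order produced by \<open>l3\<close>.\<close>
      using fundamental_identity [of ?u x2 x3 x4 x5]
      by (simp add: l3 br_zero d_simps s0 ds br_cyclic [of ?u] br_cyclic [of "br x2 x3 ?u"]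
          br_cyclic [of x5 x3] flip: s_add)
    show "l3_of br pl (deg0 x1) (deg0 x2) (l3_of br pl (deg1 f) (deg0 x4) (deg0 x5)) =
         l3_of br pl (l3_of br pl (deg0 x1) (deg0 x2) (deg1 f)) (deg0 x4) (deg0 x5)
           + l3_of br pl (deg1 f) (l3_of br pl (deg0 x1) (deg0 x2) (deg0 x4)) (deg0 x5)
           + l3_of br pl (deg1 f) (deg0 x4) (l3_of br pl (deg0 x1) (deg0 x2) (deg0 x5))"
      \<comment> \<open>Here the functional sits inside the inner bracket, so \<open>?u\<close>
        takes the third place of the identity.\<close>
      using fundamental_identity [of x1 x2 ?u x4 x5]
      by (simp add: l3 br_zero d_simps s0 ds br_cyclic [of ?u] br_cyclic [of "br x1 x2 ?u"]
          flip: s_add)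
  qed
qed

end
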